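(* Let $P_0\in\mathbb{C}[z]$ be a polynomial of degree $d\ge1$ and, for $j=0,1,\dots,d-1$, let $F_j(z)=\int_0^z t^je^{P_0(t)}\,dt$. The field $\mathbb{K}_{P_0}=\mathbb{C}(z,F_0,\dots,F_{d-1})$ and the ring $\mathbb{A}_{P_0}=\mathbb{C}[z,F_0,\dots,F_{d-1}]$ are Picard–Vessiot extensions of $\mathbb{C}[z]$, i.e. they are generated by a fundamental system of solutions of a homogeneous linear differential equation with coefficients in $\mathbb{C}[z]$. Moreover, these extensions are Liouville extensions.
   Context: The derivation is $d/dz$. A Picard–Vessiot extension of a differential ring $\mathbb{A}$ is a differential ring extension generated by a fundamental system of solutions $u_1,\dots,u_n$ of a homogeneous linear differential equation $y^{(n)}+b_{n-1}y^{(n-1)}+\dots+b_1y'+b_0y=0$ with $b_j\in\mathbb{A}$, and such that the ring of constants of the extension coincides with the ring of constants of $\mathbb{A}$ (for the field $\mathbb{K}_{P_0}$, "generated" is understood as a differential field). A Liouville extension is a Picard–Vessiot extension generated by successive adjunctions of integrals or of exponentials of integrals. *)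

theory Defs
  imports "HOL-Complex_Analysis.Complex_Analysis" "HOL-Algebra.Generated_Fields"
begin

section \<open>Differential rings and fields\<close>

locale differential_ring = cring R for R (structure) +
  fixes D :: "'a \<Rightarrow> 'a"
  assumes D_closed: "x \<in> carrier R \<Longrightarrow> D x \<in> carrier R"
    and D_add: "x \<in> carrier R \<Longrightarrow> y \<in> carrier R \<Longrightarrow> D (x \<oplus> y) = D x \<oplus> D y"
    and D_mult: "x \<in> carrier R \<Longrightarrow> y \<in> carrier R \<Longrightarrow>
                   D (x \<otimes> y) = (D x \<otimes> y) \<oplus> (x \<otimes> D y)"

locale differential_field = differential_ring R D + field R for R (structure) and D

text \<open>
  All differential rings below are differential subrings of one ambient
  differential ring (or field) \<open>L\<close> with derivation \<open>D\<close>.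
\<close>

definition diff_subring :: "('a, 'b) ring_scheme \<Rightarrow> ('a \<Rightarrow> 'a) \<Rightarrow> 'a set \<Rightarrow> bool" where
  "diff_subring L D B \<longleftrightarrow> subring B L \<and> (\<forall>x\<in>B. D x \<in> B)"

definition diff_subfield :: "('a, 'b) ring_scheme \<Rightarrow> ('a \<Rightarrow> 'a) \<Rightarrow> 'a set \<Rightarrow> bool" where
  "diff_subfield L D B \<longleftrightarrow> subfield B L \<and> (\<forall>x\<in>B. D x \<in> B)"

definition diff_ring_generated :: "('a, 'b) ring_scheme \<Rightarrow> ('a \<Rightarrow> 'a) \<Rightarrow> 'a set \<Rightarrow> 'a set" where
  "diff_ring_generated L D S = \<Inter>{B. diff_subring L D B \<and> S \<subseteq> B}"

definition diff_field_generated :: "('a, 'b) ring_scheme \<Rightarrow> ('a \<Rightarrow> 'a) \<Rightarrow> 'a set \<Rightarrow> 'a set" where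
  "diff_field_generated L D S = \<Inter>{B. diff_subfield L D B \<and> S \<subseteq> B}"

definition constants :: "('a, 'b) ring_scheme \<Rightarrow> ('a \<Rightarrow> 'a) \<Rightarrow> 'a set \<Rightarrow> 'a set" where
  "constants L D B = {c \<in> B. D c = \<zero>\<^bsub>L\<^esub>}"


section \<open>Picard--Vessiot extensions\<close>

text \<open>The equation \<open>y\<^sup>(\<^sup>n\<^sup>) + b\<^sub>n\<^sub>-\<^sub>1 y\<^sup>(\<^sup>n\<^sup>-\<^sup>1\<^sup>) + \<dots> + b\<^sub>0 y = 0\<close>, with coefficients \<open>b i\<close> for \<open>i < n\<close>.\<close>

definition solves_linear_ode ::
  "('a, 'b) ring_scheme \<Rightarrow> ('a \<Rightarrow> 'a) \<Rightarrow> nat \<Rightarrow> (nat \<Rightarrow> 'a) \<Rightarrow> 'a \<Rightarrow> bool" where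
  "solves_linear_ode L D n b y \<longleftrightarrow>
     (D ^^ n) y \<oplus>\<^bsub>L\<^esub> (\<Oplus>\<^bsub>L\<^esub>i\<in>{..<n}. b i \<otimes>\<^bsub>L\<^esub> (D ^^ i) y) = \<zero>\<^bsub>L\<^esub>"

text \<open>
  A fundamental system in \<open>B\<close> of the equation of order \<open>n\<close>: exactly \<open>n\<close> solutions, forming a
  basis of the solutions in \<open>B\<close> over the ring of constants of \<open>B\<close>.
\<close>

definition fundamental_system ::
  "('a, 'b) ring_scheme \<Rightarrow> ('a \<Rightarrow> 'a) \<Rightarrow> 'a set \<Rightarrow> nat \<Rightarrow> (nat \<Rightarrow> 'a) \<Rightarrow> (nat \<Rightarrow> 'a) \<Rightarrow> bool" where
  "fundamental_system L D B n b u \<longleftrightarrow>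
     (\<forall>i<n. u i \<in> B \<and> solves_linear_ode L D n b (u i)) \<and>
     (\<forall>c. (\<forall>i<n. c i \<in> constants L D B) \<longrightarrow>
          (\<Oplus>\<^bsub>L\<^esub>i\<in>{..<n}. c i \<otimes>\<^bsub>L\<^esub> u i) = \<zero>\<^bsub>L\<^esub> \<longrightarrow> (\<forall>i<n. c i = \<zero>\<^bsub>L\<^esub>)) \<and>
     (\<forall>y\<in>B. solves_linear_ode L D n b y \<longrightarrow>
          (\<exists>c. (\<forall>i<n. c i \<in> constants L D B) \<and> y = (\<Oplus>\<^bsub>L\<^esub>i\<in>{..<n}. c i \<otimes>\<^bsub>L\<^esub> u i)))"

text \<open>
  The parameter \<open>gen\<close> is the closure operator in whose sense \<open>B\<close> is generated over \<open>A\<close>: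
  as a differential ring or as a differential field.
\<close>

definition picard_vessiot_wrt ::
  "('a set \<Rightarrow> 'a set) \<Rightarrow> ('a, 'b) ring_scheme \<Rightarrow> ('a \<Rightarrow> 'a) \<Rightarrow> 'a set \<Rightarrow> 'a set \<Rightarrow> bool" where
  "picard_vessiot_wrt gen L D A B \<longleftrightarrow>
     diff_subring L D A \<and> diff_subring L D B \<and> A \<subseteq> B \<and>
     (\<exists>n b u. n \<ge> 1 \<and> (\<forall>i<n. b i \<in> A) \<and>
        fundamental_system L D B n b u \<and> B = gen (A \<union> u ` {..<n})) \<and>
     constants L D B = constants L D A"

definition picard_vessiot_ring ::
  "('a, 'b) ring_scheme \<Rightarrow> ('a \<Rightarrow> 'a) \<Rightarrow> 'a set \<Rightarrow> 'a set \<Rightarrow> bool" where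
  "picard_vessiot_ring L D A B \<longleftrightarrow>
     differential_ring L D \<and> picard_vessiot_wrt (diff_ring_generated L D) L D A B"

definition picard_vessiot_field ::
  "('a, 'b) ring_scheme \<Rightarrow> ('a \<Rightarrow> 'a) \<Rightarrow> 'a set \<Rightarrow> 'a set \<Rightarrow> bool" where
  "picard_vessiot_field L D A B \<longleftrightarrow>
     differential_field L D \<and> diff_subfield L D B \<and>
     picard_vessiot_wrt (diff_field_generated L D) L D A B"


section \<open>Liouville extensions\<close>

definition integral_over :: "('a \<Rightarrow> 'a) \<Rightarrow> 'a set \<Rightarrow> 'a \<Rightarrow> bool" where
  "integral_over D E t \<longleftrightarrow> D t \<in> E"

text \<open>Exponentials of integrals in the sense of differential algebra: \<open>t'/t \<in> E\<close>.\<close>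

definition exp_integral_over ::
  "('a, 'b) ring_scheme \<Rightarrow> ('a \<Rightarrow> 'a) \<Rightarrow> 'a set \<Rightarrow> 'a \<Rightarrow> bool" where
  "exp_integral_over L D E t \<longleftrightarrow> t \<noteq> \<zero>\<^bsub>L\<^esub> \<and> (\<exists>a\<in>E. D t = a \<otimes>\<^bsub>L\<^esub> t)"

inductive liouville_tower ::
  "('a set \<Rightarrow> 'a set) \<Rightarrow> ('a, 'b) ring_scheme \<Rightarrow> ('a \<Rightarrow> 'a) \<Rightarrow> 'a set \<Rightarrow> 'a set \<Rightarrow> bool"
  for gen L D A where
  base: "liouville_tower gen L D A (gen A)"
| adjoin: "\<lbrakk>liouville_tower gen L D A E; t \<in> carrier L;
            integral_over D E t \<or> exp_integral_over L D E t\<rbrakk>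
           \<Longrightarrow> liouville_tower gen L D A (gen (insert t E))"

definition liouville_ring ::
  "('a, 'b) ring_scheme \<Rightarrow> ('a \<Rightarrow> 'a) \<Rightarrow> 'a set \<Rightarrow> 'a set \<Rightarrow> bool" where
  "liouville_ring L D A B \<longleftrightarrow>
     picard_vessiot_ring L D A B \<and> liouville_tower (diff_ring_generated L D) L D A B"

definition liouville_field ::
  "('a, 'b) ring_scheme \<Rightarrow> ('a \<Rightarrow> 'a) \<Rightarrow> 'a set \<Rightarrow> 'a set \<Rightarrow> bool" where
  "liouville_field L D A B \<longleftrightarrow>
     picard_vessiot_field L D A B \<and> liouville_tower (diff_field_generated L D) L D A B"


section \<open>The differential field of meromorphic functions on the plane\<close>

text \<open>
  Meromorphic functions are represented by their normal forms \<^const>\<open>nicely_meromorphic_on\<close>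
  (removable singularities removed, value 0 at poles), so that equality of functions is
  equality in the field; \<^const>\<open>remove_sings\<close> renormalizes the pointwise operations.
\<close>

definition mero :: "(complex \<Rightarrow> complex) ring" where
  "mero = \<lparr>carrier = {f. f nicely_meromorphic_on UNIV},
           mult = (\<lambda>f g. remove_sings (\<lambda>z. f z * g z)),
           one = (\<lambda>_. 1),
           zero = (\<lambda>_. 0),
           add = (\<lambda>f g. remove_sings (\<lambda>z. f z + g z))\<rparr>"

definition mero_deriv :: "(complex \<Rightarrow> complex) \<Rightarrow> complex \<Rightarrow> complex" where
  "mero_deriv f = remove_sings (deriv f)"

definition polynomial_functions :: "(complex \<Rightarrow> complex) set" where
  "polynomial_functions = range poly"

definition F :: "complex poly \<Rightarrow> nat \<Rightarrow> complex \<Rightarrow> complex" where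
  "F P j z = contour_integral (linepath 0 z) (\<lambda>t. t ^ j * exp (poly P t))"

definition A_ring :: "complex poly \<Rightarrow> (complex \<Rightarrow> complex) set" where
  "A_ring P = generate_ring mero (polynomial_functions \<union> F P ` {..<degree P})"

definition K_field :: "complex poly \<Rightarrow> (complex \<Rightarrow> complex) set" where
  "K_field P = generate_field mero (polynomial_functions \<union> F P ` {..<degree P})"

end

theory Submission
  imports Defs
begin

text \<open>
  Write \<open>e = exp P\<close>. The derivatives of the integrals are \<open>F\<^sub>j' = z\<^sup>j e\<close>, so a function
  \<open>y\<close> is a combination of \<open>1, F\<^sub>0, \<dots>, F\<^sub>d\<^sub>-\<^sub>1\<close> with constant coefficients exactly when
  \<open>y' / e\<close> is a polynomial of degree less than \<open>d\<close>, that is, when the \<open>d\<close>-th derivative of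
  \<open>y' / e\<close> vanishes. Conjugating the derivation by \<open>e\<close> turns this condition into
  \<open>(D - P')\<^sup>d (D y) = 0\<close>, a monic linear differential equation of order \<open>d + 1\<close> whose
  coefficients are polynomials. Hence \<open>1, F\<^sub>0, \<dots>, F\<^sub>d\<^sub>-\<^sub>1\<close> is a fundamental system
  (\<open>twisted_D_pow_deriv_eq_0_iff\<close>, \<open>ode_for_F\<close>, \<open>fundamental_system_F\<close>). That it exhausts
  even the meromorphic solutions rests on one analytic fact: a meromorphic function with
  derivative 0 is constant (\<open>mero_deriv_eq_0_imp_const\<close>). The same fact shows that no new
  constants appear in the extensions.

  Integrating \<open>P' e = e'\<close> gives \<open>e = e(0) + \<Sum>\<^sub>j p\<^sub>j F\<^sub>j\<close>, where \<open>P' = \<Sum>\<^sub>j p\<^sub>j z\<^sup>j\<close>, so \<open>e\<close>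
  already lies in the ring generated by the integrals (\<open>exp_eq_F_combination\<close>). Two things
  follow. This ring and the corresponding field are closed under the derivation, hence they are
  also the differential ring and the differential field generated by the fundamental system.
  And they are Liouville extensions: adjoin first \<open>e\<close>, for which \<open>e' / e = P'\<close>, and then the
  integrals \<open>F\<^sub>j\<close> one after another (\<open>liouville_tower_F\<close>).
\<close>

section \<open>Differential algebra\<close>

context differential_ring
begin

lemma D_one: "D \<one> = \<zero>"
  by (metis D_closed D_mult add.l_cancel_one' l_one one_closed r_one)

lemma D_zero: "D \<zero> = \<zero>"
  by (metis D_add D_closed add.l_cancel_one' l_zero zero_closed)

lemma D_minus:
  assumes "x \<in> carrier R"
  shows "D (\<ominus> x) = \<ominus> D x"
proof -
  have "D (\<ominus> x) \<oplus> D x = \<zero>"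
    using D_add[of "\<ominus> x" x] assms by (simp add: l_neg D_zero)
  then show ?thesis
    using assms D_closed minus_equality by simp
qed

lemma D_finsum:
  assumes "\<And>i. f i \<in> carrier R"
  shows "D (\<Oplus>i\<in>{..<n::nat}. f i) = (\<Oplus>i\<in>{..<n}. D (f i))"
proof (induction n)
  case 0
  then show ?case by (simp add: D_zero)
next
  case (Suc n)
  have "{..<Suc n} = insert n {..<n}" by auto
  then show ?case
    using Suc assms by (simp add: finsum_insert D_add D_closed Pi_def finsum_closed)
qed

lemma D_pow_closed: "x \<in> carrier R \<Longrightarrow> (D ^^ k) x \<in> carrier R"
  by (induction k) (auto simp: D_closed)

text \<open>
  By the sum and product rules, closure under the derivation has to be checked only on
  generators; the corresponding fact for fields uses the quotient rule as well. It identifies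
  differential generation with purely algebraic generation.
\<close>

lemma diff_subring_generate_ring:
  assumes S: "S \<subseteq> carrier R" and D: "\<And>x. x \<in> S \<Longrightarrow> D x \<in> generate_ring R S"
  shows "diff_subring R D (generate_ring R S)"
  unfolding diff_subring_def
proof (intro conjI ballI)
  show "subring (generate_ring R S) R"
    using S by (rule generate_ring_is_subring)
next
  fix x assume "x \<in> generate_ring R S"
  then show "D x \<in> generate_ring R S"
  proof induction
    case one
    then show ?case by (simp add: D_one zero_in_generate)
  next
    case (incl h)
    then show ?case by (rule D)
  next
    case (a_inv h)
    then show ?case
      using generate_ring_in_carrier[OF S] by (simp add: D_minus generate_ring.a_inv)
  next
    case (eng_add h1 h2)
    then show ?case
      using generate_ring_in_carrier[OF S] by (simp add: D_add generate_ring.eng_add)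
  next
    case (eng_mult h1 h2)
    then show ?case
      using generate_ring_in_carrier[OF S]
      by (simp add: D_mult generate_ring.eng_add generate_ring.eng_mult)
  qed
qed

lemma diff_ring_generated_eq_generate_ring:
  assumes "S \<subseteq> carrier R" "\<And>x. x \<in> S \<Longrightarrow> D x \<in> generate_ring R S"
  shows "diff_ring_generated R D S = generate_ring R S"
proof
  have "diff_subring R D (generate_ring R S)" "S \<subseteq> generate_ring R S"
    using diff_subring_generate_ring[OF assms] by (simp_all add: generate_ring.incl subsetI)
  then show "diff_ring_generated R D S \<subseteq> generate_ring R S"
    unfolding diff_ring_generated_def by (intro Inter_lower) simp
  show "generate_ring R S \<subseteq> diff_ring_generated R D S"
    unfolding diff_ring_generated_def diff_subring_def
    by (intro Inter_greatest) (simp add: generate_ring_min_subring1[OF assms(1)])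
qed

lemma finsum_lessThan_Suc:
  assumes "\<And>i. f i \<in> carrier R"
  shows "(\<Oplus>i\<in>{..<Suc n}. f i) = f n \<oplus> (\<Oplus>i\<in>{..<n}. f i)"
proof -
  have "{..<Suc n} = insert n {..<n}" by auto
  then show ?thesis
    using assms by (simp add: finsum_insert)
qed

lemma finsum_lessThan_Suc_shift:
  assumes f: "\<And>i::nat. f i \<in> carrier R"
  shows "(\<Oplus>i\<in>{..<Suc n}. f i) = f 0 \<oplus> (\<Oplus>i\<in>{..<n}. f (Suc i))"
proof (induction n)
  case 0
  then show ?case using f by (simp add: finsum_lessThan_Suc)
next
  case (Suc n)
  then have "(\<Oplus>i\<in>{..<Suc (Suc n)}. f i) = f (Suc n) \<oplus> (f 0 \<oplus> (\<Oplus>i\<in>{..<n}. f (Suc i)))"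
    using finsum_lessThan_Suc[of f "Suc n"] f by simp
  also have "\<dots> = f 0 \<oplus> (f (Suc n) \<oplus> (\<Oplus>i\<in>{..<n}. f (Suc i)))"
    using f by (simp add: a_lcomm finsum_closed Pi_def)
  also have "\<dots> = f 0 \<oplus> (\<Oplus>i\<in>{..<Suc n}. f (Suc i))"
    using finsum_lessThan_Suc[of "\<lambda>i. f (Suc i)" n] f by simp
  finally show ?case .
qed

text \<open>
  If \<open>e' = - q e\<close>, the operator \<open>y \<mapsto> y' + q y\<close> is the derivation conjugated by \<open>e\<close>, so its
  powers act on \<open>w e\<close> by differentiating \<open>w\<close>. On the other hand these powers are monic linear
  differential operators with coefficients in any differential subring that contains \<open>q\<close>.
  Together the two facts produce a monic equation over the small ring whose solutions are
  known explicitly in the large one.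
\<close>

definition twisted_D :: "'a \<Rightarrow> 'a \<Rightarrow> 'a" where
  "twisted_D q y = D y \<oplus> q \<otimes> y"

lemma twisted_D_pow_mult:
  assumes e: "e \<in> carrier R" and q: "q \<in> carrier R" "D e \<oplus> q \<otimes> e = \<zero>" and w: "w \<in> carrier R"
  shows "(twisted_D q ^^ k) (w \<otimes> e) = (D ^^ k) w \<otimes> e"
proof (induction k)
  case (Suc k)
  let ?w = "(D ^^ k) w"
  have c: "?w \<in> carrier R" using w by (rule D_pow_closed)
  have "twisted_D q (?w \<otimes> e) = D ?w \<otimes> e \<oplus> (?w \<otimes> D e \<oplus> q \<otimes> (?w \<otimes> e))"
    using c e q D_closed by (simp add: twisted_D_def D_mult a_assoc)
  also have "q \<otimes> (?w \<otimes> e) = ?w \<otimes> (q \<otimes> e)"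
    using c e q by (simp add: m_lcomm)
  also have "?w \<otimes> D e \<oplus> ?w \<otimes> (q \<otimes> e) = ?w \<otimes> (D e \<oplus> q \<otimes> e)"
    using c e q(1) D_closed by (simp add: r_distr)
  finally show ?case
    using Suc c e q D_closed by simp
qed simp

lemma twisted_D_pow_expand:
  assumes A: "diff_subring R D A" and q: "q \<in> A"
  shows "\<exists>b. (\<forall>i. b i \<in> A) \<and>
    (\<forall>y\<in>carrier R. (twisted_D q ^^ k) y = (D ^^ k) y \<oplus> (\<Oplus>i\<in>{..<k}. b i \<otimes> (D ^^ i) y))"
proof (induction k)
  case 0
  have "\<zero> \<in> A" using A by (simp add: diff_subring_def subringE)
  then show ?case by (intro exI[of _ "\<lambda>_. \<zero>"]) simp
next
  case (Suc k)
  note sub = A[unfolded diff_subring_def, THEN conjunct1]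
  note AD = A[unfolded diff_subring_def, THEN conjunct2, rule_format]
  note Ac = subsetD[OF subringE(1)[OF sub]]
  from Suc obtain b where b: "\<And>i. b i \<in> A"
    and eq: "\<And>y. y \<in> carrier R \<Longrightarrow>
      (twisted_D q ^^ k) y = (D ^^ k) y \<oplus> (\<Oplus>i\<in>{..<k}. b i \<otimes> (D ^^ i) y)"
    by blast
  note bc = Ac[OF b] and qc = Ac[OF q]
  have Dbc: "D (b i) \<in> carrier R" for i using AD[OF b] Ac by blast
  \<comment> \<open>The coefficient of \<open>y\<^sup>(\<^sup>i\<^sup>)\<close> collects \<open>b\<^sub>i' + q b\<^sub>i\<close> and the shifted \<open>b\<^sub>i\<^sub>-\<^sub>1\<close>; for \<open>i = k\<close>
    the leading term contributes \<open>q\<close> in place of the former.\<close>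
  define lo where "lo i = (if i = k then q else D (b i) \<oplus> q \<otimes> b i)" for i
  define hi where "hi i = (case i of 0 \<Rightarrow> \<zero> | Suc j \<Rightarrow> b j)" for i
  have lo: "lo i \<in> A" for i
    using b q AD by (auto simp: lo_def subringE[OF sub])
  have hi: "hi i \<in> A" for i
    using b by (auto simp: hi_def subringE[OF sub] split: nat.split)
  note loc = Ac[OF lo] and hic = Ac[OF hi]
  show ?case
  proof (intro exI[of _ "\<lambda>i. lo i \<oplus> hi i"] conjI allI ballI)
    show "lo i \<oplus> hi i \<in> A" for i
      using lo hi by (simp add: subringE[OF sub])
  next
    fix y assume y: "y \<in> carrier R"
    let ?d = "\<lambda>i. (D ^^ i) y"
    let ?s1 = "\<Oplus>i\<in>{..<k}. D (b i) \<otimes> ?d i" and ?s2 = "\<Oplus>i\<in>{..<k}. q \<otimes> (b i \<otimes> ?d i)"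
    let ?s3 = "\<Oplus>i\<in>{..<k}. b i \<otimes> ?d (Suc i)"
    note dc = D_pow_closed[OF y]
    have dSc: "D (?d i) \<in> carrier R" for i using dc D_closed by blast
    have sc: "?s1 \<in> carrier R" "?s2 \<in> carrier R" "?s3 \<in> carrier R"
      using dc dSc bc qc Dbc by (auto intro!: finsum_closed)
    have lo_sum: "(\<Oplus>i\<in>{..<Suc k}. lo i \<otimes> ?d i) = q \<otimes> ?d k \<oplus> (?s1 \<oplus> ?s2)"
    proof -
      have "(\<Oplus>i\<in>{..<k}. lo i \<otimes> ?d i) = (\<Oplus>i\<in>{..<k}. D (b i) \<otimes> ?d i \<oplus> q \<otimes> (b i \<otimes> ?d i))"
        using dc bc qc Dbc by (intro finsum_cong') (auto simp: lo_def l_distr m_assoc)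
      also have "\<dots> = ?s1 \<oplus> ?s2"
        using dc bc qc Dbc by (intro finsum_addf) auto
      finally show ?thesis
        using dc loc by (subst finsum_lessThan_Suc) (auto simp: lo_def)
    qed
    have hi_sum: "(\<Oplus>i\<in>{..<Suc k}. hi i \<otimes> ?d i) = ?s3"
      using finsum_lessThan_Suc_shift[of "\<lambda>i. hi i \<otimes> ?d i" k] hic dc sc(3) y
      by (simp add: hi_def)
    have "D (\<Oplus>i\<in>{..<k}. b i \<otimes> ?d i) = (\<Oplus>i\<in>{..<k}. D (b i) \<otimes> ?d i \<oplus> b i \<otimes> ?d (Suc i))"
      using bc dc by (simp add: D_finsum D_mult)
    also have "\<dots> = ?s1 \<oplus> ?s3"
      using dc dSc bc Dbc by (intro finsum_addf) auto
    finally have D_sum: "D (\<Oplus>i\<in>{..<k}. b i \<otimes> ?d i) = ?s1 \<oplus> ?s3" .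
    have q_sum: "q \<otimes> (\<Oplus>i\<in>{..<k}. b i \<otimes> ?d i) = ?s2"
      using qc bc dc by (intro finsum_rdistr) auto
    have "(twisted_D q ^^ Suc k) y = twisted_D q (?d k \<oplus> (\<Oplus>i\<in>{..<k}. b i \<otimes> ?d i))"
      using eq[OF y] by simp
    also have "\<dots> = (D (?d k) \<oplus> (?s1 \<oplus> ?s3)) \<oplus> (q \<otimes> ?d k \<oplus> ?s2)"
      using bc dc qc by (simp add: twisted_D_def D_add finsum_closed r_distr D_sum q_sum)
    also have "\<dots> = D (?d k) \<oplus> ((q \<otimes> ?d k \<oplus> (?s1 \<oplus> ?s2)) \<oplus> ?s3)"
      using sc dc dSc qc by (simp add: a_ac)
    also have "(q \<otimes> ?d k \<oplus> (?s1 \<oplus> ?s2)) \<oplus> ?s3 = (\<Oplus>i\<in>{..<Suc k}. lo i \<otimes> ?d i \<oplus> hi i \<otimes> ?d i)"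
      unfolding lo_sum[symmetric] hi_sum[symmetric]
      using dc loc hic by (intro finsum_addf[symmetric]) auto
    also have "\<dots> = (\<Oplus>i\<in>{..<Suc k}. (lo i \<oplus> hi i) \<otimes> ?d i)"
      using dc loc hic by (intro finsum_cong') (auto simp: l_distr)
    finally show "(twisted_D q ^^ Suc k) y =
        (D ^^ Suc k) y \<oplus> (\<Oplus>i\<in>{..<Suc k}. (lo i \<oplus> hi i) \<otimes> ?d i)"
      by simp
  qed
qed

end

lemma (in differential_field) diff_subfield_generate_field:
  assumes S: "S \<subseteq> carrier R" and D: "\<And>x. x \<in> S \<Longrightarrow> D x \<in> generate_field R S"
  shows "diff_subfield R D (generate_field R S)"
  unfolding diff_subfield_def
proof (intro conjI ballI)
  show "subfield (generate_field R S) R"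
    using S by (rule generate_field_is_subfield)
next
  fix x assume "x \<in> generate_field R S"
  then show "D x \<in> generate_field R S"
  proof induction
    case one
    have "\<one> \<oplus> \<ominus> \<one> \<in> generate_field R S"
      by (rule generate_field.eng_add[OF generate_field.one generate_field.a_inv[OF generate_field.one]])
    then show ?case by (simp add: D_one r_neg)
  next
    case (incl h)
    then show ?case by (rule D)
  next
    case (a_inv h)
    then show ?case
      using generate_field_in_carrier[OF S] by (simp add: D_minus generate_field.a_inv)
  next
    case (m_inv h)
    have c: "h \<in> carrier R" "h \<in> Units R" "inv h \<in> carrier R"
      using m_inv(1,2) generate_field_in_carrier[OF S] by (auto simp: field_Units)
    have "D h \<otimes> inv h \<oplus> h \<otimes> D (inv h) = \<zero>"
      using D_mult[OF c(1,3)] c D_one by simp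
    then have "h \<otimes> D (inv h) = \<ominus> (D h \<otimes> inv h)"
      using c D_closed by (intro minus_equality[symmetric]) (simp_all add: a_comm)
    then have "inv h \<otimes> (h \<otimes> D (inv h)) = inv h \<otimes> \<ominus> (D h \<otimes> inv h)"
      by simp
    then have "D (inv h) = inv h \<otimes> \<ominus> (D h \<otimes> inv h)"
      using c D_closed by (simp add: m_assoc[symmetric])
    moreover have "inv h \<otimes> \<ominus> (D h \<otimes> inv h) \<in> generate_field R S"
      using m_inv generate_field.m_inv[OF m_inv(1,2)]
      by (blast intro: generate_field.a_inv generate_field.eng_mult)
    ultimately show ?case by simp
  next
    case (eng_add h1 h2)
    then show ?case
      using generate_field_in_carrier[OF S] by (simp add: D_add generate_field.eng_add)
  next
    case (eng_mult h1 h2)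
    then show ?case
      using generate_field_in_carrier[OF S]
      by (simp add: D_mult generate_field.eng_add generate_field.eng_mult)
  qed
qed

lemma (in differential_field) diff_field_generated_eq_generate_field:
  assumes "S \<subseteq> carrier R" "\<And>x. x \<in> S \<Longrightarrow> D x \<in> generate_field R S"
  shows "diff_field_generated R D S = generate_field R S"
proof
  have "diff_subfield R D (generate_field R S)" "S \<subseteq> generate_field R S"
    using diff_subfield_generate_field[OF assms] by (simp_all add: generate_field.incl subsetI)
  then show "diff_field_generated R D S \<subseteq> generate_field R S"
    unfolding diff_field_generated_def by (intro Inter_lower) simp
  show "generate_field R S \<subseteq> diff_field_generated R D S"
    unfolding diff_field_generated_def diff_subfield_def
    by (intro Inter_greatest) (simp add: generate_field_min_subfield1[OF assms(1)])
qed

lemma generate_ring_subset_generate_field: "generate_ring R S \<subseteq> generate_field R S"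
proof
  fix x assume "x \<in> generate_ring R S"
  then show "x \<in> generate_field R S"
    by induction (blast intro: generate_field.one generate_field.incl generate_field.a_inv
        generate_field.eng_add generate_field.eng_mult)+
qed

section \<open>The differential field of meromorphic functions\<close>

text \<open>
  Normal forms see a function only up to sparse sets. All the identities of the field are
  therefore proved by verifying them pointwise outside a sparse set.
\<close>

lemma remove_sings_eq_if_cosparse_eq:
  assumes "\<forall>\<^sub>\<approx>z\<in>UNIV. f z = g z"
  shows "remove_sings f = remove_sings g"
proof
  fix z :: complex
  show "remove_sings f z = remove_sings g z"
    using assms by (intro remove_sings_cong eventually_cosparse_imp_eventually_at) auto
qed

lemma remove_sings_nice:
  assumes "f nicely_meromorphic_on UNIV"
  shows "remove_sings f = f"
proof
  fix z
  show "remove_sings f z = f z"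
  proof (cases "is_pole f z")
    case True
    then show ?thesis
      using is_pole_zero_at_nicely_mero[OF assms True] by simp
  next
    case False
    then show ?thesis
      using nicely_meromorphic_on_imp_analytic_at[OF assms, of z] by simp
  qed
qed

lemma nice_eqI:
  assumes "f nicely_meromorphic_on UNIV" "g nicely_meromorphic_on UNIV"
    and "\<forall>\<^sub>\<approx>z\<in>UNIV. f z = g z"
  shows "f = g"
  using remove_sings_eq_if_cosparse_eq[OF assms(3)] remove_sings_nice assms(1,2) by metis

lemma mero_carrier: "f \<in> carrier mero \<longleftrightarrow> f nicely_meromorphic_on UNIV"
  by (simp add: mero_def)

lemma mero_simps:
  "\<zero>\<^bsub>mero\<^esub> = (\<lambda>_. 0)" "\<one>\<^bsub>mero\<^esub> = (\<lambda>_. 1)"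
  "f \<oplus>\<^bsub>mero\<^esub> g = remove_sings (\<lambda>z. f z + g z)"
  "f \<otimes>\<^bsub>mero\<^esub> g = remove_sings (\<lambda>z. f z * g z)"
  by (simp_all add: mero_def)

lemma nice_imp_meromorphic: "f nicely_meromorphic_on UNIV \<Longrightarrow> f meromorphic_on UNIV"
  by (simp add: nicely_meromorphic_on_def)

lemma mero_add_closed: "f \<in> carrier mero \<Longrightarrow> g \<in> carrier mero \<Longrightarrow> f \<oplus>\<^bsub>mero\<^esub> g \<in> carrier mero"
  unfolding mero_carrier mero_simps
  by (intro remove_sings_nicely_meromorphic meromorphic_intros nice_imp_meromorphic)

lemma mero_mult_closed: "f \<in> carrier mero \<Longrightarrow> g \<in> carrier mero \<Longrightarrow> f \<otimes>\<^bsub>mero\<^esub> g \<in> carrier mero"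
  unfolding mero_carrier mero_simps
  by (intro remove_sings_nicely_meromorphic meromorphic_intros nice_imp_meromorphic)

lemma mero_deriv_closed: "f \<in> carrier mero \<Longrightarrow> mero_deriv f \<in> carrier mero"
  unfolding mero_carrier mero_deriv_def
  by (intro remove_sings_nicely_meromorphic meromorphic_intros nice_imp_meromorphic)

lemma mero_const_closed: "(\<lambda>_. c) \<in> carrier mero"
  by (auto simp: mero_carrier)

text \<open>
  Away from a sparse set the renormalization does nothing, so the field operations are the
  pointwise ones there.
\<close>

lemma mero_add_cosparse:
  assumes "f \<in> carrier mero" "g \<in> carrier mero"
  shows "\<forall>\<^sub>\<approx>z\<in>UNIV. (f \<oplus>\<^bsub>mero\<^esub> g) z = f z + g z"
  using assms unfolding mero_simps mero_carrier
  by (intro eventually_remove_sings_eq meromorphic_intros nice_imp_meromorphic)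

lemma mero_mult_cosparse:
  assumes "f \<in> carrier mero" "g \<in> carrier mero"
  shows "\<forall>\<^sub>\<approx>z\<in>UNIV. (f \<otimes>\<^bsub>mero\<^esub> g) z = f z * g z"
  using assms unfolding mero_simps mero_carrier
  by (intro eventually_remove_sings_eq meromorphic_intros nice_imp_meromorphic)

lemma mero_deriv_at_analytic:
  assumes "f analytic_on {z}"
  shows "mero_deriv f z = deriv f z"
  using assms by (simp add: mero_deriv_def analytic_deriv)

lemma mero_analytic_cosparse:
  assumes "f \<in> carrier mero"
  shows "\<forall>\<^sub>\<approx>z\<in>UNIV. f analytic_on {z}"
  using assms by (intro meromorphic_on_imp_analytic_cosparse) (simp add: mero_carrier nice_imp_meromorphic)

lemma mero_eqI:
  assumes "f \<in> carrier mero" "g \<in> carrier mero" "\<forall>\<^sub>\<approx>z\<in>UNIV. f z = g z"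
  shows "f = g"
  using nice_eqI assms unfolding mero_carrier by blast

lemma cring_mero: "cring mero"
proof (rule cringI)
  show "abelian_group mero"
  proof (rule abelian_groupI)
    show "\<zero>\<^bsub>mero\<^esub> \<in> carrier mero"
      by (simp add: mero_simps mero_const_closed)
  next
    fix f g h assume c: "f \<in> carrier mero" "g \<in> carrier mero" "h \<in> carrier mero"
    show "f \<oplus>\<^bsub>mero\<^esub> g \<oplus>\<^bsub>mero\<^esub> h = f \<oplus>\<^bsub>mero\<^esub> (g \<oplus>\<^bsub>mero\<^esub> h)"
    proof (rule mero_eqI)
      show "\<forall>\<^sub>\<approx>z\<in>UNIV. (f \<oplus>\<^bsub>mero\<^esub> g \<oplus>\<^bsub>mero\<^esub> h) z = (f \<oplus>\<^bsub>mero\<^esub> (g \<oplus>\<^bsub>mero\<^esub> h)) z"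
        using mero_add_cosparse[OF c(1,2)] mero_add_cosparse[OF c(2,3)]
          mero_add_cosparse[OF mero_add_closed[OF c(1,2)] c(3)]
          mero_add_cosparse[OF c(1) mero_add_closed[OF c(2,3)]]
        by eventually_elim (simp add: algebra_simps)
    qed (use c in \<open>simp_all add: mero_add_closed\<close>)
  next
    fix f assume f: "f \<in> carrier mero"
    show "\<zero>\<^bsub>mero\<^esub> \<oplus>\<^bsub>mero\<^esub> f = f"
      using f by (simp add: mero_simps remove_sings_nice mero_carrier)
    have m: "(\<lambda>z. - f z) \<in> carrier mero"
      using f by (auto simp: mero_carrier)
    have "(\<lambda>z. - f z) \<oplus>\<^bsub>mero\<^esub> f = \<zero>\<^bsub>mero\<^esub>"
      by (simp add: mero_simps remove_sings_nice nicely_meromorphic_on_const)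
    with m show "\<exists>y\<in>carrier mero. y \<oplus>\<^bsub>mero\<^esub> f = \<zero>\<^bsub>mero\<^esub>"
      by blast
  qed (simp_all add: mero_add_closed, simp add: mero_simps add.commute)
next
  show "comm_monoid mero"
  proof (rule comm_monoidI)
    show "\<one>\<^bsub>mero\<^esub> \<in> carrier mero"
      by (simp add: mero_simps mero_const_closed)
  next
    fix f g h assume c: "f \<in> carrier mero" "g \<in> carrier mero" "h \<in> carrier mero"
    show "f \<otimes>\<^bsub>mero\<^esub> g \<otimes>\<^bsub>mero\<^esub> h = f \<otimes>\<^bsub>mero\<^esub> (g \<otimes>\<^bsub>mero\<^esub> h)"
    proof (rule mero_eqI)
      show "\<forall>\<^sub>\<approx>z\<in>UNIV. (f \<otimes>\<^bsub>mero\<^esub> g \<otimes>\<^bsub>mero\<^esub> h) z = (f \<otimes>\<^bsub>mero\<^esub> (g \<otimes>\<^bsub>mero\<^esub> h)) z"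
        using mero_mult_cosparse[OF c(1,2)] mero_mult_cosparse[OF c(2,3)]
          mero_mult_cosparse[OF mero_mult_closed[OF c(1,2)] c(3)]
          mero_mult_cosparse[OF c(1) mero_mult_closed[OF c(2,3)]]
        by eventually_elim (simp add: algebra_simps)
    qed (use c in \<open>simp_all add: mero_mult_closed\<close>)
  next
    fix f assume f: "f \<in> carrier mero"
    show "\<one>\<^bsub>mero\<^esub> \<otimes>\<^bsub>mero\<^esub> f = f"
      using f by (simp add: mero_simps remove_sings_nice mero_carrier)
  qed (simp_all add: mero_mult_closed, simp add: mero_simps mult.commute)
next
  fix f g h assume c: "f \<in> carrier mero" "g \<in> carrier mero" "h \<in> carrier mero"
  show "(f \<oplus>\<^bsub>mero\<^esub> g) \<otimes>\<^bsub>mero\<^esub> h = f \<otimes>\<^bsub>mero\<^esub> h \<oplus>\<^bsub>mero\<^esub> g \<otimes>\<^bsub>mero\<^esub> h"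
  proof (rule mero_eqI)
    show "\<forall>\<^sub>\<approx>z\<in>UNIV. ((f \<oplus>\<^bsub>mero\<^esub> g) \<otimes>\<^bsub>mero\<^esub> h) z = (f \<otimes>\<^bsub>mero\<^esub> h \<oplus>\<^bsub>mero\<^esub> g \<otimes>\<^bsub>mero\<^esub> h) z"
      using mero_add_cosparse[OF c(1,2)] mero_mult_cosparse[OF c(1,3)] mero_mult_cosparse[OF c(2,3)]
        mero_mult_cosparse[OF mero_add_closed[OF c(1,2)] c(3)]
        mero_add_cosparse[OF mero_mult_closed[OF c(1,3)] mero_mult_closed[OF c(2,3)]]
      by eventually_elim (simp add: algebra_simps)
  qed (use c in \<open>simp_all add: mero_add_closed mero_mult_closed\<close>)
qed

text \<open>
  By the identity theorem a nonzero meromorphic function vanishes only on a sparse set, so its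
  pointwise reciprocal is an inverse.
\<close>

lemma field_mero: "field mero"
proof (rule cring.cring_fieldI2[OF cring_mero])
  show "\<zero>\<^bsub>mero\<^esub> \<noteq> \<one>\<^bsub>mero\<^esub>"
    by (simp add: mero_simps fun_eq_iff)
next
  fix f assume f: "f \<in> carrier mero" "f \<noteq> \<zero>\<^bsub>mero\<^esub>"
  have "(\<forall>z\<in>UNIV. f z = 0) \<or> (\<forall>\<^sub>\<approx>z\<in>UNIV. f z \<noteq> 0)"
    using f(1) by (intro nicely_meromorphic_imp_constant_or_avoid) (simp_all add: mero_carrier connected_UNIV)
  with f(2) have nz: "\<forall>\<^sub>\<approx>z\<in>UNIV. f z \<noteq> 0"
    by (auto simp: mero_simps fun_eq_iff)
  have inv: "(\<lambda>z. inverse (f z)) \<in> carrier mero"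
    using f(1) by (simp add: mero_carrier nicely_meromorphic_on_inverse)
  have "f \<otimes>\<^bsub>mero\<^esub> (\<lambda>z. inverse (f z)) = \<one>\<^bsub>mero\<^esub>"
  proof (rule mero_eqI)
    show "\<forall>\<^sub>\<approx>z\<in>UNIV. (f \<otimes>\<^bsub>mero\<^esub> (\<lambda>z. inverse (f z))) z = \<one>\<^bsub>mero\<^esub> z"
      using mero_mult_cosparse[OF f(1) inv] nz
      by eventually_elim (simp add: mero_simps)
  qed (use f inv in \<open>simp_all add: mero_mult_closed mero_simps(2) mero_const_closed\<close>)
  with inv show "\<exists>g\<in>carrier mero. f \<otimes>\<^bsub>mero\<^esub> g = \<one>\<^bsub>mero\<^esub>"
    by blast
qed

lemma differential_field_mero: "differential_field mero mero_deriv"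
proof (intro differential_field.intro differential_ring.intro differential_ring_axioms.intro)
  fix f g assume c: "f \<in> carrier mero" "g \<in> carrier mero"
  show "mero_deriv f \<in> carrier mero"
    using c by (simp add: mero_deriv_closed)
  have an: "\<forall>\<^sub>\<approx>z\<in>UNIV. f analytic_on {z} \<and> g analytic_on {z}"
    using mero_analytic_cosparse[OF c(1)] mero_analytic_cosparse[OF c(2)] by eventually_elim simp
  show "mero_deriv (f \<oplus>\<^bsub>mero\<^esub> g) = mero_deriv f \<oplus>\<^bsub>mero\<^esub> mero_deriv g"
  proof (rule mero_eqI)
    show "\<forall>\<^sub>\<approx>z\<in>UNIV. mero_deriv (f \<oplus>\<^bsub>mero\<^esub> g) z = (mero_deriv f \<oplus>\<^bsub>mero\<^esub> mero_deriv g) z"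
      using an mero_add_cosparse[OF c[THEN mero_deriv_closed]]
        mero_analytic_cosparse[OF mero_add_closed[OF c]]
    proof eventually_elim
      case (elim z)
      have fd: "f field_differentiable at z" "g field_differentiable at z"
        using elim analytic_on_imp_differentiable_at by blast+
      have "mero_deriv (f \<oplus>\<^bsub>mero\<^esub> g) z = deriv (\<lambda>z. f z + g z) z"
        using elim by (simp add: mero_deriv_at_analytic mero_simps analytic_on_add)
      then show ?case
        using elim fd by (simp add: mero_deriv_at_analytic)
    qed
  qed (use c in \<open>simp_all add: mero_add_closed mero_deriv_closed\<close>)
  show "mero_deriv (f \<otimes>\<^bsub>mero\<^esub> g) =
      mero_deriv f \<otimes>\<^bsub>mero\<^esub> g \<oplus>\<^bsub>mero\<^esub> f \<otimes>\<^bsub>mero\<^esub> mero_deriv g"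
  proof (rule mero_eqI)
    show "\<forall>\<^sub>\<approx>z\<in>UNIV. mero_deriv (f \<otimes>\<^bsub>mero\<^esub> g) z =
        (mero_deriv f \<otimes>\<^bsub>mero\<^esub> g \<oplus>\<^bsub>mero\<^esub> f \<otimes>\<^bsub>mero\<^esub> mero_deriv g) z"
      using an mero_add_cosparse[OF mero_mult_closed[OF mero_deriv_closed[OF c(1)] c(2)]
          mero_mult_closed[OF c(1) mero_deriv_closed[OF c(2)]]]
        mero_mult_cosparse[OF mero_deriv_closed[OF c(1)] c(2)]
        mero_mult_cosparse[OF c(1) mero_deriv_closed[OF c(2)]]
        mero_analytic_cosparse[OF mero_mult_closed[OF c]]
    proof eventually_elim
      case (elim z)
      have fd: "f field_differentiable at z" "g field_differentiable at z"
        using elim analytic_on_imp_differentiable_at by blast+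
      have "mero_deriv (f \<otimes>\<^bsub>mero\<^esub> g) z = deriv (\<lambda>z. f z * g z) z"
        using elim by (simp add: mero_deriv_at_analytic mero_simps analytic_on_mult)
      then show ?case
        using elim fd by (simp add: mero_deriv_at_analytic)
    qed
  qed (use c in \<open>simp_all add: mero_add_closed mero_mult_closed mero_deriv_closed\<close>)
qed (simp_all add: cring_mero field_mero)

interpretation mero: differential_ring mero mero_deriv
  by (rule differential_field.axioms(1)[OF differential_field_mero])

text \<open>
  The complement of the poles of a meromorphic function is connected, so a vanishing derivative
  forces the function to be constant there, hence everywhere.
\<close>

lemma mero_deriv_eq_0_imp_const:
  assumes "f \<in> carrier mero" "mero_deriv f = (\<lambda>_. 0)"
  obtains c where "f = (\<lambda>_. c)"
proof -
  from assms(1)[unfolded mero_carrier]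
  obtain pts where pts: "pts sparse_in UNIV" "f analytic_on UNIV - pts"
    by (rule nicely_meromorphic_onE)
  have opn: "open (UNIV - pts)"
    using pts(1) by (simp add: open_diff_sparse_pts)
  have con: "connected (UNIV - pts)"
    using pts(1) by (intro sparse_imp_connected) (auto simp: connected_UNIV)
  have an: "f analytic_on {z}" if "z \<in> UNIV - pts" for z
    using pts(2) that analytic_on_analytic_at by blast
  have der: "(f has_field_derivative 0) (at z)" if "z \<in> UNIV - pts" for z
  proof -
    have "deriv f z = 0"
      using mero_deriv_at_analytic[OF an[OF that]] assms(2) by simp
    then show ?thesis
      using analytic_on_imp_differentiable_at[OF an[OF that], of z]
        DERIV_deriv_iff_field_differentiable[of f z] by simp
  qed
  have "\<exists>c. \<forall>z\<in>UNIV - pts. f z = c"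
    by (rule DERIV_zero_connected_constant[OF con opn finite.emptyI, of f])
      (use der pts(2) in \<open>auto intro: holomorphic_on_imp_continuous_on analytic_imp_holomorphic\<close>)
  then obtain c where c: "\<And>z. z \<in> UNIV - pts \<Longrightarrow> f z = c"
    by blast
  have "f = (\<lambda>_. c)"
    using assms(1) mero_const_closed
  proof (rule mero_eqI)
    show "\<forall>\<^sub>\<approx>z\<in>UNIV. f z = c"
      using eventually_not_in_cosparse[OF pts(1)] by eventually_elim (simp add: c)
  qed
  then show thesis
    by (rule that)
qed

section \<open>Entire functions inside the meromorphic functions\<close>

text \<open>
  Sums, products and derivatives of entire functions have no singularities, so on entire
  functions the operations of the field are the pointwise ones everywhere.
\<close>

lemma entire_carrier: "f holomorphic_on UNIV \<Longrightarrow> f \<in> carrier mero"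
  by (simp add: mero_carrier analytic_on_imp_nicely_meromorphic_on analytic_on_open)

lemma entire_add:
  assumes "f holomorphic_on UNIV" "g holomorphic_on UNIV"
  shows "f \<oplus>\<^bsub>mero\<^esub> g = (\<lambda>z. f z + g z)"
  using entire_carrier[of "\<lambda>z. f z + g z"] assms
  by (simp add: mero_simps mero_carrier remove_sings_nice holomorphic_on_add)

lemma entire_mult:
  assumes "f holomorphic_on UNIV" "g holomorphic_on UNIV"
  shows "f \<otimes>\<^bsub>mero\<^esub> g = (\<lambda>z. f z * g z)"
  using entire_carrier[of "\<lambda>z. f z * g z"] assms
  by (simp add: mero_simps mero_carrier remove_sings_nice holomorphic_on_mult)

lemma entire_deriv:
  assumes "\<And>z. (f has_field_derivative f' z) (at z)"
  shows "mero_deriv f = f'"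
proof
  fix z
  have "f holomorphic_on UNIV"
    using assms by (auto simp: holomorphic_on_def field_differentiable_def)
  then have "f analytic_on {z}"
    by (meson analytic_on_open analytic_on_subset open_UNIV subset_UNIV)
  then show "mero_deriv f z = f' z"
    using assms by (simp add: mero_deriv_at_analytic DERIV_imp_deriv)
qed

lemma entire_finsum:
  assumes "\<And>i. i < n \<Longrightarrow> f i holomorphic_on UNIV"
  shows "(\<Oplus>\<^bsub>mero\<^esub>i\<in>{..<n::nat}. f i) = (\<lambda>z. \<Sum>i<n. f i z)"
  using assms
proof (induction n)
  case 0
  then show ?case by (simp add: mero_simps)
next
  case (Suc n)
  have S: "{..<Suc n} = insert n {..<n}" by auto
  have "(\<Oplus>\<^bsub>mero\<^esub>i\<in>{..<Suc n}. f i) = f n \<oplus>\<^bsub>mero\<^esub> (\<Oplus>\<^bsub>mero\<^esub>i\<in>{..<n}. f i)"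
    unfolding S using Suc.prems by (intro mero.finsum_insert) (auto intro: entire_carrier)
  also have "(\<Oplus>\<^bsub>mero\<^esub>i\<in>{..<n}. f i) = (\<lambda>z. \<Sum>i<n. f i z)"
    using Suc by simp
  also have "f n \<oplus>\<^bsub>mero\<^esub> \<dots> = (\<lambda>z. f n z + (\<Sum>i<n. f i z))"
    using Suc.prems by (intro entire_add holomorphic_on_sum) auto
  finally show ?case by (simp add: add.commute)
qed

text \<open>
  A meromorphic antiderivative of an entire function is entire: the field element \<open>f - g\<close>
  has derivative 0, so it is a constant and cannot have inherited a pole from \<open>f\<close>.
\<close>

lemma mero_deriv_eq_imp:
  assumes f: "f \<in> carrier mero" and g: "\<And>z. (g has_field_derivative g' z) (at z)"
    and eq: "mero_deriv f = g'"
  shows "\<exists>a. f = (\<lambda>z. a + g z)"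
proof -
  have hg: "g holomorphic_on UNIV"
    using g by (auto simp: holomorphic_on_def field_differentiable_def)
  have hm: "(\<lambda>z. - g z) holomorphic_on UNIV"
    using hg by (intro holomorphic_intros)
  have hg': "g' holomorphic_on UNIV"
    using holomorphic_deriv[OF hg open_UNIV] DERIV_imp_deriv[OF g] by (metis ext)
  note c = f entire_carrier[OF hg] entire_carrier[OF hm]
  let ?h = "f \<oplus>\<^bsub>mero\<^esub> (\<lambda>z. - g z)"
  have "mero_deriv (\<lambda>z. - g z) = (\<lambda>z. - g' z)"
    using g by (intro entire_deriv DERIV_minus)
  then have "mero_deriv ?h = (\<lambda>_. 0)"
    using c hg' eq by (simp add: mero.D_add entire_add holomorphic_on_minus)
  then obtain a where a: "?h = (\<lambda>_. a)"
    using mero_deriv_eq_0_imp_const[OF mero_add_closed[OF c(1,3)]] by blast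
  have "f = f \<oplus>\<^bsub>mero\<^esub> \<zero>\<^bsub>mero\<^esub>"
    using c by simp
  also have "\<zero>\<^bsub>mero\<^esub> = (\<lambda>z. - g z) \<oplus>\<^bsub>mero\<^esub> g"
    using hg hm by (simp add: entire_add mero_simps(1))
  also have "f \<oplus>\<^bsub>mero\<^esub> \<dots> = ?h \<oplus>\<^bsub>mero\<^esub> g"
    using c by (simp add: mero.a_assoc)
  also have "\<dots> = (\<lambda>z. a + g z)"
    unfolding a using hg by (simp add: entire_add)
  finally show ?thesis by blast
qed

lemma polynomial_sum_has_derivative:
  fixes c :: "nat \<Rightarrow> complex"
  shows "((\<lambda>z. \<Sum>j<Suc k. c j * z ^ j) has_field_derivative
    (\<Sum>j<k. of_nat (Suc j) * c (Suc j) * z ^ j)) (at z)"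
  unfolding sum.lessThan_Suc_shift
  by (auto intro!: derivative_eq_intros sum.cong simp: algebra_simps simp del: of_nat_Suc power_Suc)

text \<open>
  Repeated integration: each step replaces the coefficients of a polynomial by those of an
  antiderivative, and the constant of integration becomes the new lowest coefficient.
\<close>

lemma mero_deriv_pow_eq_0_iff:
  assumes "w \<in> carrier mero"
  shows "(mero_deriv ^^ k) w = (\<lambda>_. 0) \<longleftrightarrow> (\<exists>c. w = (\<lambda>z. \<Sum>j<k. c j * z ^ j))"
  using assms
proof (induction k arbitrary: w)
  case 0
  then show ?case by simp
next
  case (Suc k)
  have "(mero_deriv ^^ Suc k) w = (mero_deriv ^^ k) (mero_deriv w)"
    by (simp add: funpow_swap1)
  then have *: "(mero_deriv ^^ Suc k) w = (\<lambda>_. 0) \<longleftrightarrow>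
      (\<exists>c. mero_deriv w = (\<lambda>z. \<Sum>j<k. c j * z ^ j))"
    using Suc.IH[OF mero_deriv_closed[OF Suc.prems]] by simp
  show ?case
    unfolding *
  proof
    assume "\<exists>c. mero_deriv w = (\<lambda>z. \<Sum>j<k. c j * z ^ j)"
    then obtain c where c: "mero_deriv w = (\<lambda>z. \<Sum>j<k. c j * z ^ j)" ..
    define c' where "c' = case_nat 0 (\<lambda>j. c j / of_nat (Suc j))"
    have d: "((\<lambda>z. \<Sum>j<Suc k. c' j * z ^ j) has_field_derivative (\<Sum>j<k. c j * z ^ j)) (at z)" for z
      using polynomial_sum_has_derivative[where c = c' and k = k and z = z]
      by (simp add: c'_def del: of_nat_Suc sum.lessThan_Suc)
    obtain a where "w = (\<lambda>z. a + (\<Sum>j<Suc k. c' j * z ^ j))"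
      using mero_deriv_eq_imp[OF Suc.prems d c] by blast
    then have "w = (\<lambda>z. \<Sum>j<Suc k. (c'(0 := a)) j * z ^ j)"
      unfolding sum.lessThan_Suc_shift by (simp add: c'_def)
    then show "\<exists>c. w = (\<lambda>z. \<Sum>j<Suc k. c j * z ^ j)"
      by (rule exI[of _ "c'(0 := a)"])
  next
    assume "\<exists>c. w = (\<lambda>z. \<Sum>j<Suc k. c j * z ^ j)"
    then obtain c where "w = (\<lambda>z. \<Sum>j<Suc k. c j * z ^ j)" ..
    then have "mero_deriv w = (\<lambda>z. \<Sum>j<k. (of_nat (Suc j) * c (Suc j)) * z ^ j)"
      using entire_deriv[OF polynomial_sum_has_derivative[of c k]] by (simp only:)
    then show "\<exists>c. mero_deriv w = (\<lambda>z. \<Sum>j<k. c j * z ^ j)"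
      by (intro exI)
  qed
qed

lemma polynomial_functions_carrier: "polynomial_functions \<subseteq> carrier mero"
  by (auto simp: polynomial_functions_def intro!: entire_carrier holomorphic_intros)

lemma const_in_polynomial_functions: "(\<lambda>_. c) \<in> polynomial_functions"
  unfolding polynomial_functions_def by (rule range_eqI[of _ _ "[:c:]"]) auto

lemma diff_subring_polynomial_functions: "diff_subring mero mero_deriv polynomial_functions"
  unfolding diff_subring_def
proof (intro conjI ballI mero.subringI)
  show "polynomial_functions \<subseteq> carrier mero"
    by (rule polynomial_functions_carrier)
  show "\<one>\<^bsub>mero\<^esub> \<in> polynomial_functions"
    by (simp add: mero_simps const_in_polynomial_functions)
next
  fix f g assume "f \<in> polynomial_functions" "g \<in> polynomial_functions"
  then obtain p q where pq: "f = poly p" "g = poly q"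
    by (auto simp: polynomial_functions_def)
  have h: "poly r holomorphic_on UNIV" for r :: "complex poly"
    by (intro holomorphic_intros)
  have "f \<otimes>\<^bsub>mero\<^esub> g = poly (p * q)" "f \<oplus>\<^bsub>mero\<^esub> g = poly (p + q)"
    by (auto simp: pq entire_mult entire_add h)
  then show "f \<otimes>\<^bsub>mero\<^esub> g \<in> polynomial_functions" "f \<oplus>\<^bsub>mero\<^esub> g \<in> polynomial_functions"
    by (auto simp: polynomial_functions_def)
  have "poly (- p) \<oplus>\<^bsub>mero\<^esub> f = \<zero>\<^bsub>mero\<^esub>"
    by (simp add: pq entire_add h mero_simps(1))
  then have "\<ominus>\<^bsub>mero\<^esub> f = poly (- p)"
    by (intro mero.minus_equality) (auto simp: pq entire_carrier h)
  then show "\<ominus>\<^bsub>mero\<^esub> f \<in> polynomial_functions"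
    by (auto simp: polynomial_functions_def)
  have "mero_deriv f = poly (pderiv p)"
    unfolding pq by (intro entire_deriv poly_DERIV)
  then show "mero_deriv f \<in> polynomial_functions"
    by (auto simp: polynomial_functions_def)
qed

lemma constants_mero:
  assumes "polynomial_functions \<subseteq> B" "B \<subseteq> carrier mero"
  shows "constants mero mero_deriv B = range (\<lambda>c _. c)"
proof
  show "constants mero mero_deriv B \<subseteq> range (\<lambda>c _. c)"
  proof
    fix f assume "f \<in> constants mero mero_deriv B"
    then have "f \<in> carrier mero" "mero_deriv f = (\<lambda>_. 0)"
      using assms by (auto simp: constants_def mero_simps)
    then obtain c where "f = (\<lambda>_. c)"
      by (rule mero_deriv_eq_0_imp_const)
    then show "f \<in> range (\<lambda>c _. c)" by simp
  qed
  have "mero_deriv (\<lambda>_. c) = (\<lambda>_. 0)" for c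
    by (intro entire_deriv) simp
  then show "range (\<lambda>c _. c) \<subseteq> constants mero mero_deriv B"
    using assms const_in_polynomial_functions by (auto simp: constants_def mero_simps)
qed

section \<open>The linear differential equation satisfied by the integrals\<close>

lemma F_has_derivative: "(F P j has_field_derivative z ^ j * exp (poly P z)) (at z)"
proof -
  have "(\<lambda>t. t ^ j * exp (poly P t)) holomorphic_on UNIV"
    by (intro holomorphic_intros)
  then obtain g where g: "\<And>z. (g has_field_derivative z ^ j * exp (poly P z)) (at z)"
    using holomorphic_convex_primitive'[of UNIV] by auto
  have "F P j z = g z - g 0" for z
    unfolding F_def using contour_integral_primitive[of UNIV g _ "linepath 0 z"] g
    by (intro contour_integral_unique) (simp add: has_field_derivative_at_within)
  then have "F P j = (\<lambda>z. g z - g 0)" ..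
  then show ?thesis
    using DERIV_diff[OF g[of z] DERIV_const[of "g 0"]] by simp
qed

lemma F_entire: "F P j holomorphic_on UNIV"
  using F_has_derivative by (auto simp: holomorphic_on_def field_differentiable_def)

lemma F_0: "F P j 0 = 0"
  by (simp add: F_def)

lemma mero_deriv_F: "mero_deriv (F P j) = (\<lambda>z. z ^ j * exp (poly P z))"
  by (intro entire_deriv F_has_derivative)

lemma F_combination_has_derivative:
  "((\<lambda>z. a + (\<Sum>j<d. c j * F P j z)) has_field_derivative
    (\<Sum>j<d. c j * z ^ j) * exp (poly P z)) (at z)"
  by (auto intro!: derivative_eq_intros F_has_derivative simp: sum_distrib_left ac_simps)

text \<open>
  Since \<open>(e\<^sup>P)' = P' e\<^sup>P\<close> and \<open>P'\<close> has degree less than \<open>deg P\<close>, the exponential itself is an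
  affine combination of the integrals. This is why the ring generated by the integrals is
  closed under the derivation.
\<close>

lemma exp_eq_F_combination:
  "exp (poly P z) = exp (poly P 0) + (\<Sum>j<degree P. Polynomial.coeff (pderiv P) j * F P j z)"
proof -
  have pd: "poly (pderiv P) z = (\<Sum>j<degree P. Polynomial.coeff (pderiv P) j * z ^ j)" for z
  proof (cases "degree P")
    case 0
    then have "pderiv P = 0" by (simp add: pderiv_eq_0_iff)
    then show ?thesis using 0 by simp
  next
    case (Suc n)
    then show ?thesis
      by (simp add: poly_altdef degree_pderiv lessThan_Suc_atMost)
  qed
  let ?g = "\<lambda>z. exp (poly P z) -
    (exp (poly P 0) + (\<Sum>j<degree P. Polynomial.coeff (pderiv P) j * F P j z))"
  have "(?g has_field_derivative 0) (at z)" for z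
    using DERIV_diff[OF DERIV_fun_exp[OF poly_DERIV[of P z]]
        F_combination_has_derivative[of "exp (poly P 0)" "Polynomial.coeff (pderiv P)" P "degree P" z]]
    by (simp add: pd)
  then have "\<exists>c. \<forall>z\<in>UNIV. ?g z = c"
    by (intro has_field_derivative_zero_constant) auto
  then have "?g z = ?g 0" by (metis UNIV_I)
  then show ?thesis by (simp add: F_0)
qed

text \<open>
  With \<open>e = exp P\<close> and \<open>w = y' / e\<close>, the twisted operator for \<open>q = - P'\<close> sends
  \<open>y' = w e\<close> to \<open>w' e\<close>. So the left-hand side says that the \<open>d\<close>-th derivative of \<open>w\<close>
  vanishes, i.e. that \<open>w\<close> is a polynomial of degree less than \<open>d\<close>, and integrating
  \<open>y' = w e\<close> produces the integrals \<open>F\<^sub>j\<close>.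
\<close>

lemma twisted_D_pow_deriv_eq_0_iff:
  assumes y: "y \<in> carrier mero"
  shows "(mero.twisted_D (poly (- pderiv P)) ^^ d) (mero_deriv y) = \<zero>\<^bsub>mero\<^esub> \<longleftrightarrow>
    (\<exists>a c. y = (\<lambda>z. a + (\<Sum>j<d. c j * F P j z)))"
proof -
  define e e' q where "e = (\<lambda>z. exp (poly P z))" and "e' = (\<lambda>z. exp (- poly P z))"
    and "q = poly (- pderiv P)"
  have h: "e holomorphic_on UNIV" "e' holomorphic_on UNIV" "q holomorphic_on UNIV"
    unfolding e_def e'_def q_def by (intro holomorphic_intros)+
  note c = h[THEN entire_carrier]
  have ee': "e \<otimes>\<^bsub>mero\<^esub> e' = \<one>\<^bsub>mero\<^esub>" "e' \<otimes>\<^bsub>mero\<^esub> e = \<one>\<^bsub>mero\<^esub>"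
    using h by (auto simp: entire_mult mero_simps(2)) (auto simp: e_def e'_def exp_minus)
  have "mero_deriv e = (\<lambda>z. exp (poly P z) * poly (pderiv P) z)"
    unfolding e_def by (intro entire_deriv DERIV_fun_exp poly_DERIV)
  moreover have "(\<lambda>z. exp (poly P z) * poly (pderiv P) z) holomorphic_on UNIV"
    by (intro holomorphic_intros)
  moreover have "(\<lambda>z. q z * e z) holomorphic_on UNIV"
    using h by (intro holomorphic_intros)
  ultimately have De: "mero_deriv e \<oplus>\<^bsub>mero\<^esub> q \<otimes>\<^bsub>mero\<^esub> e = \<zero>\<^bsub>mero\<^esub>"
    using h by (simp add: entire_mult entire_add mero_simps(1)) (simp add: e_def q_def)
  have Dy: "mero_deriv y \<in> carrier mero"
    using y by (rule mero_deriv_closed)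
  define w where "w = mero_deriv y \<otimes>\<^bsub>mero\<^esub> e'"
  have wc: "w \<in> carrier mero"
    unfolding w_def using Dy c by simp
  have we: "w \<otimes>\<^bsub>mero\<^esub> e = mero_deriv y"
    unfolding w_def using Dy c ee' by (simp add: mero.m_assoc)
  have Dwc: "(mero_deriv ^^ d) w \<in> carrier mero"
    using wc by (rule mero.D_pow_closed)
  have "(mero.twisted_D q ^^ d) (mero_deriv y) = (mero_deriv ^^ d) w \<otimes>\<^bsub>mero\<^esub> e"
    unfolding we[symmetric] using c De wc by (intro mero.twisted_D_pow_mult)
  then have "(mero.twisted_D q ^^ d) (mero_deriv y) = \<zero>\<^bsub>mero\<^esub> \<longleftrightarrow>
      (mero_deriv ^^ d) w \<otimes>\<^bsub>mero\<^esub> e = \<zero>\<^bsub>mero\<^esub>"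
    by simp
  also have "\<dots> \<longleftrightarrow> (mero_deriv ^^ d) w = \<zero>\<^bsub>mero\<^esub>"
  proof
    assume "(mero_deriv ^^ d) w \<otimes>\<^bsub>mero\<^esub> e = \<zero>\<^bsub>mero\<^esub>"
    then have "(mero_deriv ^^ d) w \<otimes>\<^bsub>mero\<^esub> e \<otimes>\<^bsub>mero\<^esub> e' = \<zero>\<^bsub>mero\<^esub>"
      using c by simp
    then show "(mero_deriv ^^ d) w = \<zero>\<^bsub>mero\<^esub>"
      using Dwc c ee' by (simp add: mero.m_assoc)
  qed (use c in simp)
  also have "\<dots> \<longleftrightarrow> (\<exists>c. w = (\<lambda>z. \<Sum>j<d. c j * z ^ j))"
    using mero_deriv_pow_eq_0_iff[OF wc] by (simp add: mero_simps)
  also have "\<dots> \<longleftrightarrow> (\<exists>a c. y = (\<lambda>z. a + (\<Sum>j<d. c j * F P j z)))"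
  proof
    assume "\<exists>c. w = (\<lambda>z. \<Sum>j<d. c j * z ^ j)"
    then obtain c where "w = (\<lambda>z. \<Sum>j<d. c j * z ^ j)" ..
    moreover have "(\<lambda>z. \<Sum>j<d. c j * z ^ j) holomorphic_on UNIV"
      by (intro holomorphic_intros)
    ultimately have "mero_deriv y = (\<lambda>z. (\<Sum>j<d. c j * z ^ j) * exp (poly P z))"
      using we h by (simp add: entire_mult) (simp add: e_def)
    from mero_deriv_eq_imp[OF y F_combination_has_derivative[of 0 c] this]
    show "\<exists>a c. y = (\<lambda>z. a + (\<Sum>j<d. c j * F P j z))" by auto
  next
    assume "\<exists>a c. y = (\<lambda>z. a + (\<Sum>j<d. c j * F P j z))"
    then obtain a c where "y = (\<lambda>z. a + (\<Sum>j<d. c j * F P j z))" by blast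
    then have *: "mero_deriv y = (\<lambda>z. (\<Sum>j<d. c j * z ^ j) * exp (poly P z))"
      using entire_deriv[OF F_combination_has_derivative] by simp
    have "(\<lambda>z. (\<Sum>j<d. c j * z ^ j) * exp (poly P z)) holomorphic_on UNIV"
      by (intro holomorphic_intros)
    then have "w = (\<lambda>z. \<Sum>j<d. c j * z ^ j)"
      unfolding w_def * using h by (simp add: entire_mult) (simp add: e'_def mult.assoc exp_minus_inverse)
    then show "\<exists>c. w = (\<lambda>z. \<Sum>j<d. c j * z ^ j)" by (rule exI[of _ c])
  qed
  finally show ?thesis
    unfolding q_def .
qed

lemma ode_for_F:
  "\<exists>b. (\<forall>i. b i \<in> polynomial_functions) \<and>
    (\<forall>y\<in>carrier mero. solves_linear_ode mero mero_deriv (Suc d) b y \<longleftrightarrow>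
      (\<exists>a c. y = (\<lambda>z. a + (\<Sum>j<d. c j * F P j z))))"
proof -
  let ?q = "poly (- pderiv P)"
  have "?q \<in> polynomial_functions"
    by (auto simp: polynomial_functions_def)
  then obtain b where b: "\<And>i. b i \<in> polynomial_functions"
    and exp: "\<And>y. y \<in> carrier mero \<Longrightarrow> (mero.twisted_D ?q ^^ d) y =
      (mero_deriv ^^ d) y \<oplus>\<^bsub>mero\<^esub> (\<Oplus>\<^bsub>mero\<^esub>i\<in>{..<d}. b i \<otimes>\<^bsub>mero\<^esub> (mero_deriv ^^ i) y)"
    using mero.twisted_D_pow_expand[OF diff_subring_polynomial_functions] by meson
  note bc = subsetD[OF polynomial_functions_carrier b]
  \<comment> \<open>The operator acts on \<open>y'\<close>, so as an operator on \<open>y\<close> its coefficients move up by one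
    and the coefficient of \<open>y\<close> is 0.\<close>
  define b' where "b' = case_nat (\<lambda>_. 0) b"
  have b': "b' i \<in> polynomial_functions" for i
    using b const_in_polynomial_functions by (auto simp: b'_def split: nat.split)
  show ?thesis
  proof (intro exI[of _ b'] conjI allI ballI)
    fix y assume y: "y \<in> carrier mero"
    note dc = mero.D_pow_closed[OF y]
    have sc: "(\<Oplus>\<^bsub>mero\<^esub>i\<in>{..<d}. b i \<otimes>\<^bsub>mero\<^esub> (mero_deriv ^^ Suc i) y) \<in> carrier mero"
      using dc bc by (intro mero.finsum_closed Pi_I mero.m_closed)
    have z: "b' 0 \<otimes>\<^bsub>mero\<^esub> y = \<zero>\<^bsub>mero\<^esub>"
      using y mero.l_null by (simp add: b'_def mero_simps(1)[symmetric])
    have "(\<Oplus>\<^bsub>mero\<^esub>i\<in>{..<Suc d}. b' i \<otimes>\<^bsub>mero\<^esub> (mero_deriv ^^ i) y) =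
        b' 0 \<otimes>\<^bsub>mero\<^esub> (mero_deriv ^^ 0) y \<oplus>\<^bsub>mero\<^esub>
        (\<Oplus>\<^bsub>mero\<^esub>i\<in>{..<d}. b' (Suc i) \<otimes>\<^bsub>mero\<^esub> (mero_deriv ^^ Suc i) y)"
      using dc subsetD[OF polynomial_functions_carrier b']
      by (intro mero.finsum_lessThan_Suc_shift) (rule mero.m_closed)
    also have "\<dots> = (\<Oplus>\<^bsub>mero\<^esub>i\<in>{..<d}. b i \<otimes>\<^bsub>mero\<^esub> (mero_deriv ^^ Suc i) y)"
      using z sc by (simp add: b'_def)
    finally have "(mero_deriv ^^ Suc d) y \<oplus>\<^bsub>mero\<^esub>
          (\<Oplus>\<^bsub>mero\<^esub>i\<in>{..<Suc d}. b' i \<otimes>\<^bsub>mero\<^esub> (mero_deriv ^^ i) y) =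
        (mero_deriv ^^ d) (mero_deriv y) \<oplus>\<^bsub>mero\<^esub>
          (\<Oplus>\<^bsub>mero\<^esub>i\<in>{..<d}. b i \<otimes>\<^bsub>mero\<^esub> (mero_deriv ^^ i) (mero_deriv y))"
      by (simp only: funpow_Suc_right o_apply)
    also have "\<dots> = (mero.twisted_D ?q ^^ d) (mero_deriv y)"
      by (rule exp[OF mero_deriv_closed[OF y], symmetric])
    finally show "solves_linear_ode mero mero_deriv (Suc d) b' y \<longleftrightarrow>
        (\<exists>a c. y = (\<lambda>z. a + (\<Sum>j<d. c j * F P j z)))"
      unfolding solves_linear_ode_def by (simp only: twisted_D_pow_deriv_eq_0_iff[OF y])
  qed (rule b')
qed

text \<open>
  At 0 all the integrals vanish, which isolates \<open>a\<close>; differentiating and cancelling the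
  exponential leaves a polynomial identity for the \<open>c\<^sub>j\<close>.
\<close>

lemma F_combination_eq_0:
  assumes "(\<lambda>z. a + (\<Sum>j<d. c j * F P j z)) = (\<lambda>_. 0)"
  shows "a = 0" "j < d \<Longrightarrow> c j = 0"
proof -
  show "a = 0"
    using fun_cong[OF assms, of 0] by (simp add: F_0)
  have "(\<Sum>j<d. c j * z ^ j) * exp (poly P z) = 0" for z
    using F_combination_has_derivative[of a c P d z] unfolding assms
    by (metis DERIV_const DERIV_unique)
  then have "(\<Sum>j<d. c j * z ^ j) = 0" for z
    by simp
  then have "\<forall>z. (\<Sum>j\<le>d. (if j < d then c j else 0) * z ^ j) = 0"
    by (simp add: lessThan_Suc_atMost[symmetric])
  then have "\<forall>j\<le>d. (if j < d then c j else 0) = 0"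
    using polyfun_eq_0[of "\<lambda>j. if j < d then c j else 0" d] by blast
  then show "c j = 0" if "j < d"
    using that by (metis less_imp_le)
qed

lemma finsum_constants_mult:
  assumes "\<And>i. i < Suc d \<Longrightarrow> c i = (\<lambda>_. a i)"
  shows "(\<Oplus>\<^bsub>mero\<^esub>i\<in>{..<Suc d}. c i \<otimes>\<^bsub>mero\<^esub> case_nat (\<lambda>_. 1) (F P) i) =
    (\<lambda>z. a 0 + (\<Sum>j<d. a (Suc j) * F P j z))"
proof -
  let ?u = "case_nat (\<lambda>_. 1) (F P)"
  have u: "?u i holomorphic_on UNIV" for i
    by (auto simp: F_entire split: nat.split)
  have h: "(\<lambda>z. a i * ?u i z) holomorphic_on UNIV" for i
    using u[of i] by (intro holomorphic_intros)
  have "(\<Oplus>\<^bsub>mero\<^esub>i\<in>{..<Suc d}. c i \<otimes>\<^bsub>mero\<^esub> ?u i) = (\<Oplus>\<^bsub>mero\<^esub>i\<in>{..<Suc d}. (\<lambda>z. a i * ?u i z))"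
    using h u assms by (intro mero.finsum_cong') (auto simp: entire_carrier entire_mult)
  also have "\<dots> = (\<lambda>z. \<Sum>i<Suc d. a i * ?u i z)"
    using h by (intro entire_finsum)
  finally show ?thesis
    unfolding sum.lessThan_Suc_shift by simp
qed

text \<open>
  The hypothesis describes all meromorphic solutions, so the only remaining points are that the
  solutions lie in \<open>G\<close> and that their coefficients are determined.
\<close>

lemma fundamental_system_F:
  assumes G: "polynomial_functions \<subseteq> G" "F P ` {..<d} \<subseteq> G" "G \<subseteq> carrier mero"
    and sol: "\<And>y. y \<in> carrier mero \<Longrightarrow> solves_linear_ode mero mero_deriv (Suc d) b y \<longleftrightarrow>
      (\<exists>a c. y = (\<lambda>z. a + (\<Sum>j<d. c j * F P j z)))"
  shows "fundamental_system mero mero_deriv G (Suc d) b (case_nat (\<lambda>_. 1) (F P))"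
  unfolding fundamental_system_def constants_mero[OF G(1,3)]
proof (intro conjI allI ballI impI)
  let ?u = "case_nat (\<lambda>_. 1) (F P)"
  fix i assume i: "i < Suc d"
  show uG: "?u i \<in> G"
    using i G const_in_polynomial_functions by (auto split: nat.split)
  have "\<exists>a c. ?u i = (\<lambda>z. a + (\<Sum>j<d. c j * F P j z))"
    using i by (intro exI[of _ "if i = 0 then 1 else 0"] exI[of _ "\<lambda>j. if Suc j = i then 1 else 0"])
       (cases i; simp add: if_distrib[of "\<lambda>x. x * _"] sum.delta cong: if_cong)
  then show "solves_linear_ode mero mero_deriv (Suc d) b (?u i)"
    using sol[of "?u i"] uG G(3) by blast
next
  fix c :: "nat \<Rightarrow> complex \<Rightarrow> complex" and i
  assume c: "\<forall>i<Suc d. c i \<in> range (\<lambda>c _. c)" and i: "i < Suc d"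
    and eq: "(\<Oplus>\<^bsub>mero\<^esub>i\<in>{..<Suc d}. c i \<otimes>\<^bsub>mero\<^esub> case_nat (\<lambda>_. 1) (F P) i) = \<zero>\<^bsub>mero\<^esub>"
  from c have a: "c i = (\<lambda>_. c i 0)" if "i < Suc d" for i
    using that by fastforce
  have "(\<lambda>z. c 0 0 + (\<Sum>j<d. c (Suc j) 0 * F P j z)) = (\<lambda>_. 0)"
    using eq finsum_constants_mult[of d c "\<lambda>i. c i 0" P, OF a] by (simp add: mero_simps)
  note zero = F_combination_eq_0[OF this]
  have "c i 0 = 0"
    using i zero by (cases i) auto
  then show "c i = \<zero>\<^bsub>mero\<^esub>"
    using a[OF i] by (simp add: mero_simps)
next
  fix y assume "y \<in> G" "solves_linear_ode mero mero_deriv (Suc d) b y"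
  then obtain a c where y: "y = (\<lambda>z. a + (\<Sum>j<d. c j * F P j z))"
    using sol G(3) by blast
  let ?c = "\<lambda>i _. case_nat a c i"
  show "\<exists>c. (\<forall>i<Suc d. c i \<in> range (\<lambda>c _. c)) \<and>
      y = (\<Oplus>\<^bsub>mero\<^esub>i\<in>{..<Suc d}. c i \<otimes>\<^bsub>mero\<^esub> case_nat (\<lambda>_. 1) (F P) i)"
    using finsum_constants_mult[of d ?c "case_nat a c" P] y
    by (intro exI[of _ ?c]) simp
qed

section \<open>The Picard--Vessiot and Liouville properties\<close>

lemma exp_in_subring:
  assumes B: "subring B mero" "polynomial_functions \<subseteq> B" "F P ` {..<degree P} \<subseteq> B"
  shows "(\<lambda>z. exp (poly P z)) \<in> B"
proof -
  have *: "(\<lambda>z. exp (poly P 0) + (\<Sum>j<k. Polynomial.coeff (pderiv P) j * F P j z)) \<in> B"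
    if "k \<le> degree P" for k
    using that
  proof (induction k)
    case 0
    then show ?case using B(2) const_in_polynomial_functions by auto
  next
    case (Suc k)
    let ?s = "\<lambda>z. exp (poly P 0) + (\<Sum>j<k. Polynomial.coeff (pderiv P) j * F P j z)"
    have "(\<lambda>_. Polynomial.coeff (pderiv P) k) \<otimes>\<^bsub>mero\<^esub> F P k \<in> B"
      using Suc.prems B const_in_polynomial_functions by (intro subringE(6)[OF B(1)]) auto
    then have "?s \<oplus>\<^bsub>mero\<^esub> (\<lambda>z. Polynomial.coeff (pderiv P) k * F P k z) \<in> B"
      using Suc by (intro subringE(7)[OF B(1)]) (auto simp: entire_mult F_entire)
    moreover have "?s holomorphic_on UNIV" "(\<lambda>z. Polynomial.coeff (pderiv P) k * F P k z) holomorphic_on UNIV"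
      by (intro holomorphic_intros F_entire)+
    ultimately show ?case
      by (simp add: entire_add add.assoc)
  qed
  have "(\<lambda>z. exp (poly P z)) =
      (\<lambda>z. exp (poly P 0) + (\<Sum>j<degree P. Polynomial.coeff (pderiv P) j * F P j z))"
    using exp_eq_F_combination by (rule ext)
  then show ?thesis
    using *[OF order.refl] by simp
qed

lemma mero_deriv_F_in_subring:
  assumes "subring B mero" "polynomial_functions \<subseteq> B" "(\<lambda>z. exp (poly P z)) \<in> B"
  shows "mero_deriv (F P j) \<in> B"
proof -
  have "(\<lambda>z. z ^ j) \<in> polynomial_functions"
    unfolding polynomial_functions_def by (rule range_eqI[of _ _ "Polynomial.monom 1 j"]) (auto simp: poly_monom)
  then have "(\<lambda>z. z ^ j) \<otimes>\<^bsub>mero\<^esub> (\<lambda>z. exp (poly P z)) \<in> B"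
    using assms by (intro subringE(6)[OF assms(1)]) auto
  moreover have "(\<lambda>z. z ^ j) holomorphic_on UNIV" "(\<lambda>z. exp (poly P z)) holomorphic_on UNIV"
    by (intro holomorphic_intros)+
  ultimately show ?thesis
    by (simp add: mero_deriv_F entire_mult)
qed

lemma subring_hull:
  assumes "\<And>B. Q B \<Longrightarrow> subring B mero" "Q G" "S \<subseteq> G"
  shows "subring (Q hull S) mero"
  unfolding hull_def using assms by (intro mero.subring_Inter) auto

text \<open>
  Both kinds of generation are hulls, so the two extensions can be treated simultaneously:
  \<open>Q\<close> is the property of being a differential subring or a differential subfield.
\<close>

lemma picard_vessiot_wrt_F:
  assumes Q: "\<And>B. Q B \<Longrightarrow> diff_subring mero mero_deriv B"
    and G: "Q G" "G = Q hull (polynomial_functions \<union> F P ` {..<d})"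
  shows "picard_vessiot_wrt ((hull) Q) mero mero_deriv polynomial_functions G"
  unfolding picard_vessiot_wrt_def
proof (intro conjI)
  show "diff_subring mero mero_deriv G"
    using Q G(1) .
  then have GC: "G \<subseteq> carrier mero"
    unfolding diff_subring_def using subringE(1) by blast
  have sub: "polynomial_functions \<subseteq> G" "F P ` {..<d} \<subseteq> G"
    unfolding G(2) using hull_subset[of "polynomial_functions \<union> F P ` {..<d}" Q] by auto
  show "polynomial_functions \<subseteq> G" by fact
  show "constants mero mero_deriv G = constants mero mero_deriv polynomial_functions"
    using constants_mero[OF sub(1) GC] constants_mero[OF order.refl polynomial_functions_carrier]
    by simp
  obtain b where b: "\<And>i. b i \<in> polynomial_functions"
    and sol: "\<And>y. y \<in> carrier mero \<Longrightarrow> solves_linear_ode mero mero_deriv (Suc d) b y \<longleftrightarrow>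
      (\<exists>a c. y = (\<lambda>z. a + (\<Sum>j<d. c j * F P j z)))"
    using ode_for_F[of d P] by blast
  let ?u = "case_nat (\<lambda>_. 1) (F P)"
  have "?u ` {..<Suc d} = insert (\<lambda>_. 1) (F P ` {..<d})"
    by (simp add: lessThan_Suc_eq_insert_0 image_image)
  then have "polynomial_functions \<union> ?u ` {..<Suc d} = polynomial_functions \<union> F P ` {..<d}"
    using const_in_polynomial_functions by auto
  then have "G = Q hull (polynomial_functions \<union> ?u ` {..<Suc d})"
    using G(2) by simp
  then show "\<exists>n b u. 1 \<le> n \<and> (\<forall>i<n. b i \<in> polynomial_functions) \<and>
      fundamental_system mero mero_deriv G n b u \<and> G = Q hull (polynomial_functions \<union> u ` {..<n})"
    using fundamental_system_F[OF sub GC sol] b by (intro exI[of _ "Suc d"] exI conjI) auto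
qed (rule diff_subring_polynomial_functions)

text \<open>
  The tower starts with the exponential of the integral \<open>P\<close> of \<open>P'\<close>, since the derivatives of
  the \<open>F\<^sub>j\<close> lie in a stage only once it contains \<open>e\<^sup>P\<close>. The top stage is not larger than
  \<open>G\<close> because \<open>e\<^sup>P\<close> belongs to \<open>G\<close> anyway.
\<close>

lemma liouville_tower_F:
  assumes Q: "\<And>B. Q B \<Longrightarrow> diff_subring mero mero_deriv B"
    and G: "Q G" "G = Q hull (polynomial_functions \<union> F P ` {..<degree P})"
  shows "liouville_tower ((hull) Q) mero mero_deriv polynomial_functions G"
proof -
  let ?A = "polynomial_functions" and ?e = "\<lambda>z. exp (poly P z)"
  have Qs: "\<And>B. Q B \<Longrightarrow> subring B mero"
    using Q by (simp add: diff_subring_def)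
  have sub: "?A \<subseteq> G" "F P ` {..<degree P} \<subseteq> G"
    unfolding G(2) using hull_subset[of "?A \<union> F P ` {..<degree P}" Q] by auto
  have eG: "?e \<in> G"
    using exp_in_subring[OF Qs[OF G(1)] sub] .
  have h: "?e holomorphic_on UNIV" "poly (pderiv P) holomorphic_on UNIV"
    by (intro holomorphic_intros)+
  have "mero_deriv ?e = (\<lambda>z. exp (poly P z) * poly (pderiv P) z)"
    by (intro entire_deriv DERIV_fun_exp poly_DERIV)
  then have De: "mero_deriv ?e = poly (pderiv P) \<otimes>\<^bsub>mero\<^esub> ?e"
    using h by (simp add: entire_mult mult.commute)
  have tower: "liouville_tower ((hull) Q) mero mero_deriv ?A
      (Q hull (insert ?e (?A \<union> F P ` {..<k})))" if "k \<le> degree P" for k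
    using that
  proof (induction k)
    case 0
    have "poly (pderiv P) \<in> Q hull ?A"
      by (rule hull_inc) (simp add: polynomial_functions_def)
    moreover have "?e \<noteq> \<zero>\<^bsub>mero\<^esub>"
      by (simp add: mero_simps fun_eq_iff)
    ultimately have "exp_integral_over mero mero_deriv (Q hull ?A) ?e"
      unfolding exp_integral_over_def using De by blast
    then have "liouville_tower ((hull) Q) mero mero_deriv ?A (Q hull (insert ?e (Q hull ?A)))"
      using entire_carrier[OF h(1)] by (intro liouville_tower.intros) auto
    then show ?case
      by (simp flip: hull_insert)
  next
    case (Suc k)
    let ?S = "insert ?e (?A \<union> F P ` {..<k})"
    have "?S \<subseteq> G"
      using sub eG Suc.prems by auto
    then have "subring (Q hull ?S) mero"
      using subring_hull Qs G(1) by blast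
    moreover have "?S \<subseteq> Q hull ?S"
      by (rule hull_subset)
    ultimately have "integral_over mero_deriv (Q hull ?S) (F P k)"
      unfolding integral_over_def by (intro mero_deriv_F_in_subring) auto
    then have "liouville_tower ((hull) Q) mero mero_deriv ?A (Q hull (insert (F P k) (Q hull ?S)))"
      using Suc entire_carrier[OF F_entire]
      by (intro liouville_tower.adjoin[where t = "F P k" and E = "Q hull ?S"]) simp_all
    moreover have "insert (F P k) ?S = insert ?e (?A \<union> F P ` {..<Suc k})"
      by (auto simp: lessThan_Suc)
    ultimately show ?case
      by (simp flip: hull_insert)
  qed
  have "Q hull (insert ?e (?A \<union> F P ` {..<degree P})) = G"
    using eG hull_redundant_eq[of ?e Q] unfolding G(2) by metis
  then show ?thesis
    using tower[of "degree P"] by simp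
qed

lemma generators_carrier: "polynomial_functions \<union> F P ` {..<d} \<subseteq> carrier mero"
  using polynomial_functions_carrier entire_carrier[OF F_entire] by auto

text \<open>
  This needs the exponential in the ring, as \<open>F\<^sub>j' = z\<^sup>j e\<^sup>P\<close>. The field contains the ring,
  so the same statement serves the field.
\<close>

lemma mero_deriv_generator:
  assumes "f \<in> polynomial_functions \<union> F P ` {..<degree P}"
  shows "mero_deriv f \<in> A_ring P"
proof -
  have A: "subring (A_ring P) mero"
    unfolding A_ring_def by (intro mero.generate_ring_is_subring generators_carrier)
  have gen: "polynomial_functions \<subseteq> A_ring P" "F P ` {..<degree P} \<subseteq> A_ring P"
    unfolding A_ring_def by (auto intro: generate_ring.incl)
  show ?thesis
    using assms
  proof
    assume "f \<in> polynomial_functions"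
    then show ?thesis
      using diff_subring_polynomial_functions gen(1) by (auto simp: diff_subring_def)
  next
    assume "f \<in> F P ` {..<degree P}"
    then show ?thesis
      using mero_deriv_F_in_subring[OF A gen(1) exp_in_subring[OF A gen]] by auto
  qed
qed

theorem mainTheorem9:
  fixes P\<^sub>0 :: "complex poly" and d :: nat
  assumes "degree P\<^sub>0 = d" and "d \<ge> 1"
  shows "picard_vessiot_field mero mero_deriv polynomial_functions (K_field P\<^sub>0)
       \<and> picard_vessiot_ring mero mero_deriv polynomial_functions (A_ring P\<^sub>0)
       \<and> liouville_field mero mero_deriv polynomial_functions (K_field P\<^sub>0)
       \<and> liouville_ring mero mero_deriv polynomial_functions (A_ring P\<^sub>0)"
proof -
  let ?S = "polynomial_functions \<union> F P\<^sub>0 ` {..<degree P\<^sub>0}"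
  let ?QR = "diff_subring mero mero_deriv" and ?QK = "diff_subfield mero mero_deriv"
  have hulls: "diff_ring_generated mero mero_deriv = (hull) ?QR"
    "diff_field_generated mero mero_deriv = (hull) ?QK"
    by (simp_all add: fun_eq_iff diff_ring_generated_def diff_field_generated_def hull_def)
  have QK: "?QR B" if "?QK B" for B
    using that by (simp add: diff_subring_def diff_subfield_def subfieldE(1))
  have DA: "mero_deriv f \<in> generate_ring mero ?S" if "f \<in> ?S" for f
    using mero_deriv_generator[OF that] by (simp add: A_ring_def)
  have DK: "mero_deriv f \<in> generate_field mero ?S" if "f \<in> ?S" for f
    by (rule subsetD[OF generate_ring_subset_generate_field DA[OF that]])
  have A: "?QR (A_ring P\<^sub>0)" "A_ring P\<^sub>0 = ?QR hull ?S"
    unfolding A_ring_def hulls(1)[symmetric]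
    using mero.diff_subring_generate_ring[OF generators_carrier DA]
      mero.diff_ring_generated_eq_generate_ring[OF generators_carrier DA] by simp_all
  have K: "?QK (K_field P\<^sub>0)" "K_field P\<^sub>0 = ?QK hull ?S"
    unfolding K_field_def hulls(2)[symmetric]
    using differential_field.diff_subfield_generate_field[OF differential_field_mero generators_carrier DK]
      differential_field.diff_field_generated_eq_generate_field[OF differential_field_mero
        generators_carrier DK] by simp_all
  have "picard_vessiot_ring mero mero_deriv polynomial_functions (A_ring P\<^sub>0)"
    unfolding picard_vessiot_ring_def hulls
    using picard_vessiot_wrt_F[OF _ A] mero.differential_ring_axioms by simp
  moreover have "picard_vessiot_field mero mero_deriv polynomial_functions (K_field P\<^sub>0)"
    unfolding picard_vessiot_field_def hulls
    using picard_vessiot_wrt_F[OF QK K] differential_field_mero K(1) by simp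
  ultimately show ?thesis
    unfolding liouville_ring_def liouville_field_def hulls
    using liouville_tower_F[OF _ A] liouville_tower_F[OF QK K] by simp
qed

end
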